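(* Let $X_1\subset X_0$ and $Y_1\subset Y_0$ be four normed spaces, let $0<\alpha\leq 1$, and let $\mathcal T$ be a (possibly nonlinear) mapping from $X_i$ into $Y_i$ which is globally $\alpha$-Hölderian for $i=0,1$, i.e. there are constants $M_0,M_1>0$ such that $$\|\mathcal T a-\mathcal T b\|_{Y_i}\leq M_i\|a-b\|_{X_i}^{\alpha}\qquad\text{for all }a,b\in X_i,\quad i=0,1.$$ Then, for all $a\in X_0$, all $b\in X_1$ and all $t>0$, $$K(\mathcal T a-\mathcal T b,t^\alpha;Y_0,Y_1)\leq 2\max(M_0,M_1)\,K(a-b,t;X_0,X_1)^{\alpha}.$$ Furthermore, if $X_1$ is dense in $X_0$, then this inequality also holds for all $b\in X_0$ (and all $a\in X_0$, $t>0$).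
   Context: Each couple $(X_0,X_1)$, $(Y_0,Y_1)$ is a compatible couple of normed spaces (both spaces are continuously embedded in a common Hausdorff topological vector space). For a compatible couple $(X_0,X_1)$, $g\in X_0+X_1$ and $t>0$, the Peetre $K$-functional is $$K(g,t;X_0,X_1)=\inf_{g=g_0+g_1}\big(\|g_0\|_{X_0}+t\|g_1\|_{X_1}\big),$$ the infimum being over all decompositions $g=g_0+g_1$ with $g_0\in X_0$, $g_1\in X_1$. *)

theory Defs
  imports "HOL-Analysis.Analysis"
begin

text \<open>A normed space is a linear subspace of an ambient real vector space with a norm on it.
  The values of the norm function outside the subspace are irrelevant.\<close>

record 'v nspace =
  vecs :: "'v set"
  nrm :: "'v \<Rightarrow> real"

definition normed_space :: "'v::real_vector nspace \<Rightarrow> bool" where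
  "normed_space X \<longleftrightarrow>
     subspace (vecs X) \<and>
     (\<forall>x\<in>vecs X. 0 \<le> nrm X x) \<and>
     (\<forall>x\<in>vecs X. nrm X x = 0 \<longleftrightarrow> x = 0) \<and>
     (\<forall>c. \<forall>x\<in>vecs X. nrm X (c *\<^sub>R x) = \<bar>c\<bar> * nrm X x) \<and>
     (\<forall>x\<in>vecs X. \<forall>y\<in>vecs X. nrm X (x + y) \<le> nrm X x + nrm X y)"

text \<open>The locale \<^locale>\<open>Metric_space\<close> asks for nonnegativity and symmetry on the whole
  type, hence the value 0 outside the space.\<close>

definition norm_dist :: "'v::real_vector nspace \<Rightarrow> 'v \<Rightarrow> 'v \<Rightarrow> real" where
  "norm_dist X x y = (if x \<in> vecs X \<and> y \<in> vecs X then nrm X (x - y) else 0)"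

definition norm_topology :: "'v::real_vector nspace \<Rightarrow> 'v topology" where
  "norm_topology X = Metric_space.mtopology (vecs X) (norm_dist X)"

lemma Metric_space_norm_dist:
  assumes "normed_space X"
  shows "Metric_space (vecs X) (norm_dist X)"
proof
  have sub: "x - y \<in> vecs X" if "x \<in> vecs X" "y \<in> vecs X" for x y
    using assms that by (simp add: normed_space_def subspace_diff)
  show "0 \<le> norm_dist X x y" for x y
    using assms sub by (simp add: norm_dist_def normed_space_def)
  show "norm_dist X x y = norm_dist X y x" for x y
  proof -
    have "nrm X (x - y) = nrm X (y - x)" if "x \<in> vecs X" "y \<in> vecs X"
    proof -
      have "nrm X ((-1) *\<^sub>R (y - x)) = \<bar>-1\<bar> * nrm X (y - x)"
        using assms sub[OF that(2,1)] unfolding normed_space_def by blast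
      then show ?thesis by simp
    qed
    then show ?thesis by (auto simp: norm_dist_def)
  qed
  show "norm_dist X x y = 0 \<longleftrightarrow> x = y" if "x \<in> vecs X" "y \<in> vecs X" for x y
    using assms sub[OF that] that by (simp add: norm_dist_def normed_space_def)
  show "norm_dist X x z \<le> norm_dist X x y + norm_dist X y z"
    if "x \<in> vecs X" "y \<in> vecs X" "z \<in> vecs X" for x y z
  proof -
    have "nrm X ((x - y) + (y - z)) \<le> nrm X (x - y) + nrm X (y - z)"
      using assms sub[OF that(1,2)] sub[OF that(2,3)] by (simp only: normed_space_def)
    then show ?thesis using that by (simp add: norm_dist_def)
  qed
qed

definition hausdorff_tvs :: "'v::real_vector topology \<Rightarrow> bool" where
  "hausdorff_tvs E \<longleftrightarrow>
     topspace E = UNIV \<and> Hausdorff_space E \<and>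
     continuous_map (prod_topology E E) E (\<lambda>(x, y). x + y) \<and>
     continuous_map (prod_topology euclideanreal E) E (\<lambda>(c, x). c *\<^sub>R x)"

definition compatible_couple :: "'v::real_vector nspace \<Rightarrow> 'v nspace \<Rightarrow> bool" where
  "compatible_couple X0 X1 \<longleftrightarrow>
     normed_space X0 \<and> normed_space X1 \<and>
     (\<exists>E. hausdorff_tvs E \<and>
          continuous_map (norm_topology X0) E id \<and>
          continuous_map (norm_topology X1) E id)"

text \<open>Only meaningful for \<open>g\<close> in the sum of the two spaces; otherwise it is the infimum of the
  empty set.\<close>

definition K_functional :: "'v::real_vector \<Rightarrow> real \<Rightarrow> 'v nspace \<Rightarrow> 'v nspace \<Rightarrow> real" where
  "K_functional g t X0 X1 =
     Inf {nrm X0 g0 + t * nrm X1 g1 | g0 g1. g0 \<in> vecs X0 \<and> g1 \<in> vecs X1 \<and> g = g0 + g1}"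

end

theory Submission
  imports Defs
begin

text \<open>A decomposition of \<open>a - b\<close> in the domain couple can be transported through \<open>T\<close>,
  although \<open>T\<close> is not linear.
  If \<open>a - b = g0 + g1\<close> with \<open>b\<close> in \<open>vecs X1\<close>, then the intermediate point \<open>c = b + g1\<close> lies in
  \<open>vecs X1\<close> and \<open>a - c = g0\<close>. Hence \<open>T a - T b = (T a - T c) + (T c - T b)\<close>, where
  the first summand is controlled by the Hoelder condition in \<open>X0\<close> and the second by the one in
  \<open>X1\<close>. With \<open>s = nrm X0 g0 + t * nrm X1 g1\<close>, each of the two terms is at most
  \<open>max M0 M1 * s powr \<alpha>\<close>, which explains the factor 2. It remains to take the infimum over
  all decompositions, that is, to exchange it with the increasing function
  \<open>\<lambda>s. s powr \<alpha>\<close> (lemma \<open>le_K_functional_powr\<close>).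

  If \<open>b\<close> is only a limit in \<open>X0\<close> of points \<open>b'\<close> of \<open>vecs X1\<close>, then \<open>b'\<close> takes the place of \<open>b\<close>
  above, with \<open>c = b' + g1\<close>. This perturbs \<open>a - c\<close> and
  \<open>T a - T b\<close> by terms whose norms in \<open>X0\<close> and \<open>Y0\<close> tend to 0 with \<open>b - b'\<close>. So a single
  argument (lemma \<open>hoelder_K_functional_le\<close>), stated for points \<open>b\<close> that are approximable from
  \<open>vecs X1\<close>, covers both halves: \<open>b\<close> in \<open>vecs X1\<close> approximates itself, and density makes every
  point of \<open>vecs X0\<close> approximable.\<close>

section \<open>Norms on subspaces\<close>

lemma normed_space_subspace: "normed_space X \<Longrightarrow> subspace (vecs X)"
  by (simp add: normed_space_def)

lemma nrm_nonneg: "normed_space X \<Longrightarrow> x \<in> vecs X \<Longrightarrow> 0 \<le> nrm X x"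
  by (simp add: normed_space_def)

lemma nrm_zero: "normed_space X \<Longrightarrow> nrm X 0 = 0"
  by (simp add: normed_space_def subspace_0)

lemma nrm_triangle:
  "normed_space X \<Longrightarrow> x \<in> vecs X \<Longrightarrow> y \<in> vecs X \<Longrightarrow> nrm X (x + y) \<le> nrm X x + nrm X y"
  by (simp add: normed_space_def)

lemma nrm_minus_commute:
  assumes "normed_space X" "x \<in> vecs X" "y \<in> vecs X"
  shows "nrm X (x - y) = nrm X (y - x)"
proof -
  have "y - x \<in> vecs X"
    using assms by (simp add: normed_space_subspace subspace_diff)
  then have "nrm X ((-1) *\<^sub>R (y - x)) = \<bar>-1\<bar> * nrm X (y - x)"
    using assms(1) unfolding normed_space_def by blast
  then show ?thesis by simp
qed

lemma norm_closure_approx: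
  assumes X: "normed_space X" and b: "b \<in> norm_topology X closure_of S" and "0 < e"
  obtains b' where "b' \<in> S" "b' \<in> vecs X" "nrm X (b - b') < e"
proof -
  interpret Metric_space "vecs X" "norm_dist X"
    using X by (rule Metric_space_norm_dist)
  obtain b' where "b' \<in> S" "b' \<in> mball b e"
    using b \<open>0 < e\<close> unfolding norm_topology_def metric_closure_of by blast
  then show thesis
    using that by (auto simp: in_mball norm_dist_def split: if_splits)
qed

section \<open>The K-functional as an infimum\<close>

lemma K_functional_le:
  assumes "normed_space X0" "normed_space X1" "g0 \<in> vecs X0" "g1 \<in> vecs X1" "0 \<le> t"
  shows "K_functional (g0 + g1) t X0 X1 \<le> nrm X0 g0 + t * nrm X1 g1"
  unfolding K_functional_def
proof (rule cInf_lower)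
  show "bdd_below {nrm X0 h0 + t * nrm X1 h1 | h0 h1.
          h0 \<in> vecs X0 \<and> h1 \<in> vecs X1 \<and> g0 + g1 = h0 + h1}"
    by (rule bdd_belowI[of _ 0]) (use assms in \<open>auto simp: nrm_nonneg\<close>)
qed (use assms in blast)

text \<open>For \<open>L \<ge> 0\<close> the hypothesis says that \<open>(L / C) powr (1 / \<alpha>)\<close> is a lower bound of the set
  whose infimum is the K-functional. For \<open>L < 0\<close> the conclusion holds by positivity of the
  right-hand side. The assumption on \<open>g\<close> makes sure that this set is nonempty.\<close>

lemma le_K_functional_powr:
  assumes X: "normed_space X0" "normed_space X1" and g: "g \<in> vecs X0"
    and "0 \<le> t" "0 < C" "0 < \<alpha>"
    and bound: "\<And>g0 g1. g0 \<in> vecs X0 \<Longrightarrow> g1 \<in> vecs X1 \<Longrightarrow> g = g0 + g1 \<Longrightarrow>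
                  L \<le> C * (nrm X0 g0 + t * nrm X1 g1) powr \<alpha>"
  shows "L \<le> C * K_functional g t X0 X1 powr \<alpha>"
proof (cases "0 \<le> L")
  case False
  then show ?thesis
    using \<open>0 < C\<close> by (smt (verit) mult_nonneg_nonneg powr_ge_zero)
next
  case True
  have "(L / C) powr (1 / \<alpha>) \<le> K_functional g t X0 X1"
    unfolding K_functional_def
  proof (rule cInf_greatest)
    show "{nrm X0 g0 + t * nrm X1 g1 | g0 g1.
            g0 \<in> vecs X0 \<and> g1 \<in> vecs X1 \<and> g = g0 + g1} \<noteq> {}"
      using g subspace_0[OF normed_space_subspace[OF X(2)]] by force
  next
    fix s assume "s \<in> {nrm X0 g0 + t * nrm X1 g1 | g0 g1.
                        g0 \<in> vecs X0 \<and> g1 \<in> vecs X1 \<and> g = g0 + g1}"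
    then obtain g0 g1 where s: "s = nrm X0 g0 + t * nrm X1 g1"
      and dec: "g0 \<in> vecs X0" "g1 \<in> vecs X1" "g = g0 + g1" by blast
    have "0 \<le> s"
      using s dec X \<open>0 \<le> t\<close> by (simp add: nrm_nonneg)
    have "L / C \<le> s powr \<alpha>"
      using bound[OF dec] \<open>0 < C\<close> s by (simp add: field_simps)
    then have "(L / C) powr (1 / \<alpha>) \<le> (s powr \<alpha>) powr (1 / \<alpha>)"
      using True \<open>0 < C\<close> \<open>0 < \<alpha>\<close> by (intro powr_mono2) auto
    then show "(L / C) powr (1 / \<alpha>) \<le> s"
      using \<open>0 \<le> s\<close> \<open>0 < \<alpha>\<close> by (simp add: powr_powr)
  qed
  then have "((L / C) powr (1 / \<alpha>)) powr \<alpha> \<le> K_functional g t X0 X1 powr \<alpha>"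
    using \<open>0 < \<alpha>\<close> by (intro powr_mono2) auto
  then have "L / C \<le> K_functional g t X0 X1 powr \<alpha>"
    using True \<open>0 < C\<close> \<open>0 < \<alpha>\<close> by (simp add: powr_powr)
  then show ?thesis
    using \<open>0 < C\<close> by (simp add: field_simps)
qed

section \<open>Transporting decompositions through a Hoelder map\<close>

text \<open>The intermediate point is \<open>c = b' + g1\<close>, which lies in \<open>vecs X1\<close> even if \<open>b\<close> does not;
  the error terms in \<open>e\<close> are the price for replacing \<open>b\<close> by \<open>b'\<close>.\<close>

lemma K_functional_hoelder_decomposition:
  assumes X: "normed_space X0" "normed_space X1" and Y: "normed_space Y0" "normed_space Y1"
    and sub: "vecs X1 \<subseteq> vecs X0" and "0 < \<alpha>" "0 \<le> M0" "0 \<le> M1" "0 \<le> t"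
    and T: "T \<in> vecs X0 \<rightarrow> vecs Y0" "T \<in> vecs X1 \<rightarrow> vecs Y1"
    and H0: "\<forall>a\<in>vecs X0. \<forall>b\<in>vecs X0. nrm Y0 (T a - T b) \<le> M0 * nrm X0 (a - b) powr \<alpha>"
    and H1: "\<forall>a\<in>vecs X1. \<forall>b\<in>vecs X1. nrm Y1 (T a - T b) \<le> M1 * nrm X1 (a - b) powr \<alpha>"
    and ab: "a \<in> vecs X0" "b \<in> vecs X0" "a - b = g0 + g1"
    and g: "g0 \<in> vecs X0" "g1 \<in> vecs X1"
    and b': "b' \<in> vecs X1" "nrm X0 (b - b') \<le> e"
  shows "K_functional (T a - T b) (t powr \<alpha>) Y0 Y1
           \<le> 2 * max M0 M1 * (nrm X0 g0 + t * nrm X1 g1 + e) powr \<alpha> + M0 * e powr \<alpha>"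
proof -
  define c where "c = b' + g1"
  define s where "s = nrm X0 g0 + t * nrm X1 g1"
  note sX = normed_space_subspace[OF X(1)] normed_space_subspace[OF X(2)]
  note sY = normed_space_subspace[OF Y(1)] normed_space_subspace[OF Y(2)]
  have c: "c \<in> vecs X1" "c \<in> vecs X0"
    using b'(1) g(2) sX sub by (auto simp: c_def subspace_add)
  have b'0: "b' \<in> vecs X0" using b'(1) sub by blast
  have d: "b - b' \<in> vecs X0" using ab(2) b'0 sX by (simp add: subspace_diff)
  have "0 \<le> e" using nrm_nonneg[OF X(1) d] b'(2) by linarith
  have n0: "0 \<le> nrm X0 g0" and n1: "0 \<le> t * nrm X1 g1"
    using X g \<open>0 \<le> t\<close> by (simp_all add: nrm_nonneg)
  have "a - c = g0 + (b - b')"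
    using ab(3) by (simp add: c_def algebra_simps)
  then have ac: "nrm X0 (a - c) \<le> nrm X0 g0 + e"
    using nrm_triangle[OF X(1) g(1) d] b'(2) by simp
  have pos: "0 \<le> nrm X0 (a - c)" "0 \<le> nrm X0 (b' - b)"
    using X ab c b'0 sX by (simp_all add: nrm_nonneg subspace_diff)

  have "nrm Y0 (T a - T c) \<le> M0 * nrm X0 (a - c) powr \<alpha>"
    using H0 ab(1) c(2) by blast
  also have "\<dots> \<le> max M0 M1 * (s + e) powr \<alpha>"
    using ac pos(1) n1 \<open>0 \<le> M0\<close> \<open>0 < \<alpha>\<close> unfolding s_def
    by (intro mult_mono powr_mono2) auto
  finally have e1: "nrm Y0 (T a - T c) \<le> max M0 M1 * (s + e) powr \<alpha>" .

  have "nrm Y0 (T b' - T b) \<le> M0 * nrm X0 (b' - b) powr \<alpha>"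
    using H0 ab(2) b'0 by blast
  also have "\<dots> \<le> M0 * e powr \<alpha>"
    using pos(2) b'(2) nrm_minus_commute[OF X(1) ab(2) b'0] \<open>0 \<le> M0\<close> \<open>0 < \<alpha>\<close>
    by (intro mult_left_mono powr_mono2) auto
  finally have e2: "nrm Y0 (T b' - T b) \<le> M0 * e powr \<alpha>" .

  have "nrm Y1 (T c - T b') \<le> M1 * nrm X1 (c - b') powr \<alpha>"
    using H1 c(1) b'(1) by blast
  then have "t powr \<alpha> * nrm Y1 (T c - T b') \<le> t powr \<alpha> * (M1 * nrm X1 g1 powr \<alpha>)"
    by (simp add: c_def mult_left_mono)
  also have "\<dots> = M1 * (t * nrm X1 g1) powr \<alpha>"
    using \<open>0 \<le> t\<close> nrm_nonneg[OF X(2) g(2)] by (simp add: powr_mult)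
  also have "\<dots> \<le> max M0 M1 * (s + e) powr \<alpha>"
    using n0 n1 \<open>0 \<le> e\<close> \<open>0 \<le> M1\<close> \<open>0 < \<alpha>\<close> unfolding s_def
    by (intro mult_mono powr_mono2) auto
  finally have e3: "t powr \<alpha> * nrm Y1 (T c - T b') \<le> max M0 M1 * (s + e) powr \<alpha>" .

  have mem0: "T a - T c \<in> vecs Y0" "T b' - T b \<in> vecs Y0"
    using T(1) ab c b'0 sY by (auto intro!: subspace_diff)
  have mem1: "T c - T b' \<in> vecs Y1"
    using T(2) c b' sY by (auto intro!: subspace_diff)
  have "T a - T b = ((T a - T c) + (T b' - T b)) + (T c - T b')" by simp
  then have "K_functional (T a - T b) (t powr \<alpha>) Y0 Y1
      \<le> nrm Y0 ((T a - T c) + (T b' - T b)) + t powr \<alpha> * nrm Y1 (T c - T b')"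
    using K_functional_le[OF Y subspace_add[OF sY(1) mem0] mem1, of "t powr \<alpha>"] by simp
  also have "\<dots> \<le> nrm Y0 (T a - T c) + nrm Y0 (T b' - T b) + t powr \<alpha> * nrm Y1 (T c - T b')"
    using nrm_triangle[OF Y(1) mem0] by simp
  finally show ?thesis
    using e1 e2 e3 by (simp add: s_def)
qed

text \<open>For a fixed decomposition the error terms above vanish as \<open>b'\<close> approaches \<open>b\<close>; only
  afterwards is the infimum over the decompositions taken.\<close>

lemma hoelder_K_functional_le:
  assumes X: "normed_space X0" "normed_space X1" and Y: "normed_space Y0" "normed_space Y1"
    and sub: "vecs X1 \<subseteq> vecs X0" and "0 < \<alpha>" "0 < M0" "0 \<le> M1" "0 \<le> t"
    and T: "T \<in> vecs X0 \<rightarrow> vecs Y0" "T \<in> vecs X1 \<rightarrow> vecs Y1"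
    and H0: "\<forall>a\<in>vecs X0. \<forall>b\<in>vecs X0. nrm Y0 (T a - T b) \<le> M0 * nrm X0 (a - b) powr \<alpha>"
    and H1: "\<forall>a\<in>vecs X1. \<forall>b\<in>vecs X1. nrm Y1 (T a - T b) \<le> M1 * nrm X1 (a - b) powr \<alpha>"
    and a: "a \<in> vecs X0" and b: "b \<in> vecs X0"
    and approx: "\<And>e. 0 < e \<Longrightarrow> \<exists>b'\<in>vecs X1. nrm X0 (b - b') \<le> e"
  shows "K_functional (T a - T b) (t powr \<alpha>) Y0 Y1
           \<le> 2 * max M0 M1 * K_functional (a - b) t X0 X1 powr \<alpha>"
proof (rule le_K_functional_powr[OF X])
  show "a - b \<in> vecs X0"
    using a b X by (simp add: normed_space_subspace subspace_diff)
  show "0 < 2 * max M0 M1" using \<open>0 < M0\<close> by simp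
  fix g0 g1 assume g: "g0 \<in> vecs X0" "g1 \<in> vecs X1" "a - b = g0 + g1"
  define s where "s = nrm X0 g0 + t * nrm X1 g1"
  define B where "B = (\<lambda>e. 2 * max M0 M1 * (s + e) powr \<alpha> + M0 * e powr \<alpha>)"
  have s: "0 \<le> s" using g X \<open>0 \<le> t\<close> by (simp add: s_def nrm_nonneg)
  have "continuous_on {0..} B"
    unfolding B_def using s \<open>0 < \<alpha>\<close> by (intro continuous_intros continuous_on_powr') auto
  then have "(B \<longlongrightarrow> B 0) (at 0 within {0..})"
    by (simp add: continuous_on)
  then have "(B \<longlongrightarrow> B 0) (at_right 0)"
    by (rule tendsto_within_subset) auto
  moreover have "\<forall>\<^sub>F e in at_right 0. K_functional (T a - T b) (t powr \<alpha>) Y0 Y1 \<le> B e"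
    using eventually_at_right_less[of 0]
  proof eventually_elim
    case (elim e)
    then obtain b' where "b' \<in> vecs X1" "nrm X0 (b - b') \<le> e" using approx by blast
    then show ?case
      unfolding B_def s_def
      using K_functional_hoelder_decomposition[OF X Y sub \<open>0 < \<alpha>\<close> less_imp_le[OF \<open>0 < M0\<close>]
          \<open>0 \<le> M1\<close> \<open>0 \<le> t\<close> T H0 H1 a b g(3,1,2)] by blast
  qed
  ultimately have "K_functional (T a - T b) (t powr \<alpha>) Y0 Y1 \<le> B 0"
    by (rule tendsto_lowerbound) simp
  then show "K_functional (T a - T b) (t powr \<alpha>) Y0 Y1
      \<le> 2 * max M0 M1 * (nrm X0 g0 + t * nrm X1 g1) powr \<alpha>"
    using \<open>0 < \<alpha>\<close> by (simp add: B_def s_def)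
qed (use \<open>0 \<le> t\<close> \<open>0 < \<alpha>\<close> in auto)

theorem corollary2p1p2:
  fixes X0 X1 :: "'v::real_vector nspace"
    and Y0 Y1 :: "'w::real_vector nspace"
    and T :: "'v \<Rightarrow> 'w"
    and \<alpha> M0 M1 :: real
  assumes "compatible_couple X0 X1" and "compatible_couple Y0 Y1"
    and "vecs X1 \<subseteq> vecs X0" and "vecs Y1 \<subseteq> vecs Y0"
    and "0 < \<alpha>" and "\<alpha> \<le> 1"
    and "T \<in> vecs X0 \<rightarrow> vecs Y0" and "T \<in> vecs X1 \<rightarrow> vecs Y1"
    and "0 < M0" and "0 < M1"
    and "\<forall>a\<in>vecs X0. \<forall>b\<in>vecs X0. nrm Y0 (T a - T b) \<le> M0 * nrm X0 (a - b) powr \<alpha>"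
    and "\<forall>a\<in>vecs X1. \<forall>b\<in>vecs X1. nrm Y1 (T a - T b) \<le> M1 * nrm X1 (a - b) powr \<alpha>"
  shows "(\<forall>a\<in>vecs X0. \<forall>b\<in>vecs X1. \<forall>t>0.
            K_functional (T a - T b) (t powr \<alpha>) Y0 Y1
              \<le> 2 * max M0 M1 * K_functional (a - b) t X0 X1 powr \<alpha>) \<and>
         (norm_topology X0 closure_of vecs X1 = vecs X0 \<longrightarrow>
          (\<forall>a\<in>vecs X0. \<forall>b\<in>vecs X0. \<forall>t>0.
            K_functional (T a - T b) (t powr \<alpha>) Y0 Y1
              \<le> 2 * max M0 M1 * K_functional (a - b) t X0 X1 powr \<alpha>))"
proof -
  have X: "normed_space X0" "normed_space X1" and Y: "normed_space Y0" "normed_space Y1"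
    using assms(1,2) by (auto simp: compatible_couple_def)
  have main: "K_functional (T a - T b) (t powr \<alpha>) Y0 Y1
        \<le> 2 * max M0 M1 * K_functional (a - b) t X0 X1 powr \<alpha>"
    if "a \<in> vecs X0" "b \<in> vecs X0" "0 < t"
      and "\<And>e. 0 < e \<Longrightarrow> \<exists>b'\<in>vecs X1. nrm X0 (b - b') \<le> e" for a b t
    using hoelder_K_functional_le[OF X Y \<open>vecs X1 \<subseteq> vecs X0\<close> \<open>0 < \<alpha>\<close> \<open>0 < M0\<close> _ _ assms(7,8,11,12)]
      that \<open>0 < M1\<close> by simp
  show ?thesis
  proof (intro conjI impI ballI allI)
    fix a b t assume "a \<in> vecs X0" "b \<in> vecs X1" "0 < (t::real)"
    moreover have "\<exists>b'\<in>vecs X1. nrm X0 (b - b') \<le> e" if "0 < e" for e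
      using \<open>b \<in> vecs X1\<close> that nrm_zero[OF X(1)] by (intro bexI[of _ b]) auto
    ultimately show "K_functional (T a - T b) (t powr \<alpha>) Y0 Y1
        \<le> 2 * max M0 M1 * K_functional (a - b) t X0 X1 powr \<alpha>"
      using main \<open>vecs X1 \<subseteq> vecs X0\<close> by blast
  next
    fix a b t
    assume dense: "norm_topology X0 closure_of vecs X1 = vecs X0"
      and ab: "a \<in> vecs X0" "b \<in> vecs X0" "0 < (t::real)"
    have "\<exists>b'\<in>vecs X1. nrm X0 (b - b') \<le> e" if "0 < e" for e
      using norm_closure_approx[OF X(1) _ that, of b "vecs X1"] dense ab(2)
      by (metis less_imp_le)
    then show "K_functional (T a - T b) (t powr \<alpha>) Y0 Y1
        \<le> 2 * max M0 M1 * K_functional (a - b) t X0 X1 powr \<alpha>"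
      using main ab by blast
  qed
qed

end
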